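(* Consider the problem of minimizing $f(x)$ over $x\in\mathbb{R}^n$ subject to $c_i(x)=0$ for $i\in\mathcal{E}$ and $c_i(x)\le 0$ for $i\in\mathcal{I}$ (not necessarily convex), with augmented Lagrangian $\mathbb{L}_\rho(x,\lambda,\mu)$. If the objective function $f$ is bounded from below, and the quadratically penalized objective function $$\Phi_\rho(x)=\mathbb{L}_\rho(x,0,0)=f(x)+\frac{\rho}{2}\sum_{i\in\mathcal{E}}c_i^2(x)+\frac{\rho}{2}\sum_{i\in\mathcal{I}}[c_i(x)]_+^2$$ is lower semicontinuous and level-bounded for all sufficiently large $\rho$, then strong duality holds in the sense that $$\max_{\rho>0,\lambda,\mu}\min_x\ \mathbb{L}_\rho(x,\lambda,\mu)=\min_x\max_{\rho>0,\lambda,\mu}\ \mathbb{L}_\rho(x,\lambda,\mu),$$ where $x$ ranges over $\mathbb{R}^n$, $\lambda$ over $\mathbb{R}^{|\mathcal{E}|}$, $\mu$ over $\mathbb{R}^{|\mathcal{I}|}$ and $\rho$ over $(0,+\infty)$.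
   Context: $\mathcal{E}$ and $\mathcal{I}$ are disjoint finite index sets; $f:\mathbb{R}^n\to\mathbb{R}$ and $c_i:\mathbb{R}^n\to\mathbb{R}$ ($i\in\mathcal{E}\cup\mathcal{I}$) are proper and lower semicontinuous functions, possibly nonconvex and nonsmooth. Write $[\alpha]_+=\max\{\alpha,0\}$. Augmented Lagrangian: for $\rho>0$, $$\mathbb{L}_\rho(x,\lambda,\mu)=f(x)+\sum_{i\in\mathcal{E}}\lambda_i c_i(x)+\frac{\rho}{2}\sum_{i\in\mathcal{E}}c_i^2(x)+\frac{\rho}{2}\sum_{i\in\mathcal{I}}\left(\left[\frac{\mu_i}{\rho}+c_i(x)\right]_+^2-\frac{\mu_i^2}{\rho^2}\right).$$ A function $g:\mathbb{R}^n\to\mathbb{R}$ is (lower) level-bounded if for every $\alpha\in\mathbb{R}$ the set $\{x\in\mathbb{R}^n: g(x)\le\alpha\}$ is bounded (possibly empty). In the displayed equality, $\min$ and $\max$ are understood as infimum and supremum with values in $[-\infty,+\infty]$. *)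

theory Defs
  imports "HOL-Analysis.Analysis"
begin

(* Both notions are the usual ones for extended-real-valued functions; a real-valued g enters as
   \<lambda>x. ereal (g x), for which properness holds automatically. *)
definition proper :: "('a \<Rightarrow> ereal) \<Rightarrow> bool" where
  "proper g \<longleftrightarrow> (\<forall>x. g x \<noteq> -\<infinity>) \<and> (\<exists>x. g x \<noteq> \<infinity>)"

definition lsc :: "('a::topological_space \<Rightarrow> ereal) \<Rightarrow> bool" where
  "lsc g \<longleftrightarrow> (\<forall>x. g x \<le> Liminf (at x) g)"

definition level_bounded :: "('a::metric_space \<Rightarrow> real) \<Rightarrow> bool" where
  "level_bounded g \<longleftrightarrow> (\<forall>\<alpha>. bounded {x. g x \<le> \<alpha>})"

definition pos_part :: "real \<Rightarrow> real" ("[_]\<^sub>+") where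
  "[\<alpha>]\<^sub>+ = max \<alpha> 0"

(* EE and II index the equality and inequality constraints. The multiplier vectors of
   R^|EE| and R^|II| are the elements of multipliers EE and multipliers II: functions on the
   index set, fixed to undefined outside it. *)
abbreviation multipliers :: "'i set \<Rightarrow> ('i \<Rightarrow> real) set" where
  "multipliers J \<equiv> J \<rightarrow>\<^sub>E UNIV"

definition aug_lagrangian ::
  "'i set \<Rightarrow> 'i set \<Rightarrow> ('a \<Rightarrow> real) \<Rightarrow> ('i \<Rightarrow> 'a \<Rightarrow> real) \<Rightarrow>
   real \<Rightarrow> 'a \<Rightarrow> ('i \<Rightarrow> real) \<Rightarrow> ('i \<Rightarrow> real) \<Rightarrow> real" where
  "aug_lagrangian EE II f c \<rho> x lam mu =
     f x + (\<Sum>i\<in>EE. lam i * c i x) + \<rho> / 2 * (\<Sum>i\<in>EE. (c i x)\<^sup>2)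
     + \<rho> / 2 * (\<Sum>i\<in>II. ([mu i / \<rho> + c i x]\<^sub>+)\<^sup>2 - (mu i)\<^sup>2 / \<rho>\<^sup>2)"

definition penalized_objective ::
  "'i set \<Rightarrow> 'i set \<Rightarrow> ('a \<Rightarrow> real) \<Rightarrow> ('i \<Rightarrow> 'a \<Rightarrow> real) \<Rightarrow> real \<Rightarrow> 'a \<Rightarrow> real" where
  "penalized_objective EE II f c \<rho> x =
     aug_lagrangian EE II f c \<rho> x (\<lambda>i\<in>EE. 0) (\<lambda>i\<in>II. 0)"

lemma penalized_objective_eq:
  "penalized_objective EE II f c \<rho> x =
     f x + \<rho> / 2 * (\<Sum>i\<in>EE. (c i x)\<^sup>2) + \<rho> / 2 * (\<Sum>i\<in>II. ([c i x]\<^sub>+)\<^sup>2)"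
  by (simp add: penalized_objective_def aug_lagrangian_def)

end

theory Submission
  imports Defs
begin

text \<open>
  Weak duality is the usual exchange of infimum and supremum. The reverse inequality is already
  obtained with zero multipliers, from a compactness argument in the penalty parameter. Let \<open>M\<close> be
  a real number above the dual value. Every penalized objective has infimum below \<open>M\<close>, so its
  sublevel set at height \<open>M\<close> is nonempty; for large \<open>\<rho>\<close> it is compact, by lower semicontinuity and
  level-boundedness, and it shrinks as \<open>\<rho>\<close> grows. A point \<open>x\<close> common to all these sets
  (\<open>common_sublevel_point\<close>) satisfies \<open>f x + \<rho> / 2 * V \<le> M\<close> for arbitrarily large \<open>\<rho>\<close>, where
  \<open>V\<close> is its squared constraint violation. Hence \<open>V = 0\<close>, that is, \<open>x\<close> is feasible, and
  \<open>f x \<le> M\<close> (\<open>feasible_if_penalized_bounded\<close>). At a feasible point no choice of multipliers lifts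
  the augmented Lagrangian above the objective (\<open>aug_lagrangian_le_objective\<close>), so the primal value
  is at most \<open>M\<close>. As \<open>M\<close> was arbitrary, the two values agree.
\<close>

definition feasible :: "'i set \<Rightarrow> 'i set \<Rightarrow> ('i \<Rightarrow> 'a \<Rightarrow> real) \<Rightarrow> 'a \<Rightarrow> bool" where
  "feasible EE II c x \<longleftrightarrow> (\<forall>i\<in>EE. c i x = 0) \<and> (\<forall>i\<in>II. c i x \<le> 0)"

definition violation :: "'i set \<Rightarrow> 'i set \<Rightarrow> ('i \<Rightarrow> 'a \<Rightarrow> real) \<Rightarrow> 'a \<Rightarrow> real" where
  "violation EE II c x = (\<Sum>i\<in>EE. (c i x)\<^sup>2) + (\<Sum>i\<in>II. ([c i x]\<^sub>+)\<^sup>2)"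

lemma penalized_objective_violation:
  "penalized_objective EE II f c \<rho> x = f x + \<rho> / 2 * violation EE II c x"
  by (simp add: penalized_objective_eq violation_def algebra_simps)

lemma violation_nonneg: "0 \<le> violation EE II c x"
  by (simp add: violation_def sum_nonneg)

lemma violation_eq_0_iff:
  assumes "finite EE" and "finite II"
  shows "violation EE II c x = 0 \<longleftrightarrow> feasible EE II c x"
proof -
  have "violation EE II c x = 0 \<longleftrightarrow>
      (\<Sum>i\<in>EE. (c i x)\<^sup>2) = 0 \<and> (\<Sum>i\<in>II. ([c i x]\<^sub>+)\<^sup>2) = 0"
    unfolding violation_def by (intro add_nonneg_eq_0_iff sum_nonneg) auto
  also have "\<dots> \<longleftrightarrow> feasible EE II c x"
    using assms by (auto simp: sum_nonneg_eq_0_iff feasible_def pos_part_def max_def)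
  finally show ?thesis .
qed

lemma penalized_objective_mono:
  assumes "\<rho> \<le> \<sigma>"
  shows "penalized_objective EE II f c \<rho> x \<le> penalized_objective EE II f c \<sigma> x"
  using assms by (simp add: penalized_objective_violation mult_right_mono violation_nonneg)

text \<open>
  The equality terms vanish, and an inequality term is at most its value at \<open>c i x = 0\<close>,
  which is nonpositive whatever the sign of the multiplier.
\<close>

lemma aug_lagrangian_le_objective:
  assumes "feasible EE II c x" and "0 < \<rho>"
  shows "aug_lagrangian EE II f c \<rho> x lam mu \<le> f x"
proof -
  have "([mu i / \<rho> + c i x]\<^sub>+)\<^sup>2 - (mu i)\<^sup>2 / \<rho>\<^sup>2 \<le> 0" if "i \<in> II" for i
  proof -
    have "c i x \<le> 0"
      using assms(1) that by (simp add: feasible_def)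
    then have "0 \<le> [mu i / \<rho> + c i x]\<^sub>+" "[mu i / \<rho> + c i x]\<^sub>+ \<le> \<bar>mu i / \<rho>\<bar>"
      unfolding pos_part_def by linarith+
    then have "([mu i / \<rho> + c i x]\<^sub>+)\<^sup>2 \<le> \<bar>mu i / \<rho>\<bar>\<^sup>2"
      by (intro power_mono)
    then show ?thesis
      by (simp add: power_divide)
  qed
  then have "\<rho> / 2 * (\<Sum>i\<in>II. ([mu i / \<rho> + c i x]\<^sub>+)\<^sup>2 - (mu i)\<^sup>2 / \<rho>\<^sup>2) \<le> 0"
    using assms(2) by (intro mult_nonneg_nonpos sum_nonpos) auto
  moreover have "(\<Sum>i\<in>EE. lam i * c i x) = 0" "(\<Sum>i\<in>EE. (c i x)\<^sup>2) = 0"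
    using assms(1) by (simp_all add: feasible_def)
  ultimately show ?thesis
    by (simp add: aug_lagrangian_def)
qed

text \<open>
  The limit inferior in \<open>lsc\<close> is taken over a punctured neighbourhood; the value at the
  centre is supplied by the centre itself lying outside the sublevel set.
\<close>

lemma closed_sublevel_lsc:
  assumes "lsc g"
  shows "closed {x. g x \<le> a}"
proof -
  have "\<forall>\<^sub>F y in nhds x. a < g y" if "a < g x" for x
  proof -
    have "a < Liminf (at x) g"
      using that assms by (auto simp: lsc_def intro: less_le_trans)
    then have "\<forall>\<^sub>F y in at x. a < g y"
      by (rule less_LiminfD)
    then show ?thesis
      using that by (auto simp: eventually_at_filter elim: eventually_mono)
  qed
  then have "open {x. a < g x}"
    by (subst open_subopen) (fastforce simp: eventually_nhds)
  moreover have "{x. g x \<le> a} = - {x. a < g x}"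
    by auto
  ultimately show ?thesis
    by (simp add: closed_def)
qed

lemma compact_sublevel:
  fixes g :: "'a::heine_borel \<Rightarrow> real"
  assumes "lsc (\<lambda>x. ereal (g x))" and "level_bounded g"
  shows "compact {x. g x \<le> a}"
  using closed_sublevel_lsc[OF assms(1), of "ereal a"] assms(2)
  by (simp add: level_bounded_def compact_eq_bounded_closed)

text \<open>
  The sublevel sets are nested, since the penalty grows with its parameter, so Cantor's
  intersection theorem applies along the parameters \<open>R + k\<close>.
\<close>

lemma common_sublevel_point:
  fixes f :: "'a::heine_borel \<Rightarrow> real"
  assumes lsc: "\<And>\<rho>. R \<le> \<rho> \<Longrightarrow> lsc (\<lambda>x. ereal (penalized_objective EE II f c \<rho> x))"
    and lb: "\<And>\<rho>. R \<le> \<rho> \<Longrightarrow> level_bounded (penalized_objective EE II f c \<rho>)"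
    and ne: "\<And>\<rho>. R \<le> \<rho> \<Longrightarrow> \<exists>x. penalized_objective EE II f c \<rho> x \<le> M"
  obtains x where "\<And>k::nat. penalized_objective EE II f c (R + real k) x \<le> M"
proof -
  define S where "S k = {x. penalized_objective EE II f c (R + real k) x \<le> M}" for k
  have "compact (S k)" for k
    unfolding S_def by (intro compact_sublevel lsc lb) auto
  moreover have "S k \<noteq> {}" for k
    using ne[of "R + real k"] by (auto simp: S_def)
  moreover have "S n \<subseteq> S m" if "m \<le> n" for m n
    using that unfolding S_def
    by (auto intro: order_trans[OF penalized_objective_mono[of "R + real m" "R + real n"]])
  ultimately have "\<Inter> (range S) \<noteq> {}"
    by (rule compact_nest)
  then show ?thesis
    using that by (auto simp: S_def)
qed

text \<open>A positive violation would drive the penalized objective to infinity along \<open>R + k\<close>.\<close>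

lemma feasible_if_penalized_bounded:
  assumes "finite EE" and "finite II" and "0 \<le> R"
    and bound: "\<And>k::nat. penalized_objective EE II f c (R + real k) x \<le> M"
  shows "feasible EE II c x" and "f x \<le> M"
proof -
  let ?V = "violation EE II c x"
  show "f x \<le> M"
    using bound[of 0] mult_nonneg_nonneg[OF assms(3) violation_nonneg[of EE II c x]]
    by (simp add: penalized_objective_violation)
  have "?V \<le> 0"
  proof (rule ccontr)
    assume "\<not> ?V \<le> 0"
    then have "0 < ?V" by simp
    then obtain k where k: "2 * (M - f x) < real k * ?V"
      using reals_Archimedean3 by blast
    have "0 \<le> R * ?V"
      using assms(3) violation_nonneg by (rule mult_nonneg_nonneg)
    moreover have "2 * f x + R * ?V + real k * ?V \<le> 2 * M"
      using bound[of k] by (simp add: penalized_objective_violation field_simps)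
    ultimately show False
      using k by (simp add: algebra_simps)
  qed
  then have "?V = 0"
    using violation_nonneg[of EE II c x] by linarith
  then show "feasible EE II c x"
    using assms(1,2) by (simp add: violation_eq_0_iff)
qed

theorem theorem2p10:
  fixes f :: "real ^ 'n \<Rightarrow> real"
    and c :: "'i \<Rightarrow> real ^ 'n \<Rightarrow> real"
    and EE II :: "'i set"
  assumes "finite EE" and "finite II" and "EE \<inter> II = {}"
    and "proper (\<lambda>x. ereal (f x))" and "lsc (\<lambda>x. ereal (f x))"
    and "\<And>i. i \<in> EE \<union> II \<Longrightarrow> proper (\<lambda>x. ereal (c i x))"
    and "\<And>i. i \<in> EE \<union> II \<Longrightarrow> lsc (\<lambda>x. ereal (c i x))"
    and "bdd_below (range f)"
    and "\<forall>\<^sub>F \<rho> in at_top.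
           lsc (\<lambda>x. ereal (penalized_objective EE II f c \<rho> x)) \<and>
           level_bounded (penalized_objective EE II f c \<rho>)"
  shows "(SUP (\<rho>, lam, mu) \<in> {0<..} \<times> multipliers EE \<times> multipliers II.
            INF x. ereal (aug_lagrangian EE II f c \<rho> x lam mu))
       = (INF x. SUP (\<rho>, lam, mu) \<in> {0<..} \<times> multipliers EE \<times> multipliers II.
            ereal (aug_lagrangian EE II f c \<rho> x lam mu))"
proof (rule antisym)
  let ?A = "{0<..} \<times> multipliers EE \<times> multipliers II"
  let ?L = "\<lambda>(\<rho>, lam, mu) x. ereal (aug_lagrangian EE II f c \<rho> x lam mu)"
  let ?dual = "SUP p\<in>?A. INF x. ?L p x"
  let ?primal = "INF x. SUP p\<in>?A. ?L p x"
  have dual_eq: "(SUP (\<rho>, lam, mu) \<in> ?A. INF x. ereal (aug_lagrangian EE II f c \<rho> x lam mu)) = ?dual"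
    by (simp add: case_prod_unfold)
  have primal_eq:
    "(INF x. SUP (\<rho>, lam, mu) \<in> ?A. ereal (aug_lagrangian EE II f c \<rho> x lam mu)) = ?primal"
    by (simp add: case_prod_unfold)
  have "?dual \<le> ?primal"
    by (intro SUP_least INF_greatest) (meson INF_lower SUP_upper UNIV_I order_trans)
  then show "(SUP (\<rho>, lam, mu) \<in> ?A. INF x. ereal (aug_lagrangian EE II f c \<rho> x lam mu))
      \<le> (INF x. SUP (\<rho>, lam, mu) \<in> ?A. ereal (aug_lagrangian EE II f c \<rho> x lam mu))"
    by (simp only: dual_eq primal_eq)
  obtain R0 where R0: "\<And>\<rho>. R0 \<le> \<rho> \<Longrightarrow>
      lsc (\<lambda>x. ereal (penalized_objective EE II f c \<rho> x)) \<and>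
      level_bounded (penalized_objective EE II f c \<rho>)"
    using assms(9) by (auto simp: eventually_at_top_linorder)
  \<comment> \<open>The dual only ranges over positive parameters, while \<open>R0\<close> may be negative.\<close>
  define R where "R = max R0 1"
  have "?primal \<le> ereal M" if M: "?dual < ereal M" for M
  proof -
    \<comment> \<open>Zero multipliers are a dual candidate, so \<open>INF x. penalized_objective EE II f c \<rho> x\<close> is at most the dual value.\<close>
    have "\<exists>x. penalized_objective EE II f c \<rho> x \<le> M" if "R \<le> \<rho>" for \<rho>
    proof -
      have "(\<rho>, \<lambda>i\<in>EE. 0, \<lambda>i\<in>II. 0) \<in> ?A"
        using that by (auto simp: R_def)
      then have "(INF x. ?L (\<rho>, \<lambda>i\<in>EE. 0, \<lambda>i\<in>II. 0) x) < ereal M"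
        using M by (rule le_less_trans[OF SUP_upper])
      then have "\<exists>x. ereal (penalized_objective EE II f c \<rho> x) < ereal M"
        by (simp add: INF_less_iff penalized_objective_def)
      then show ?thesis
        by (auto intro: less_imp_le)
    qed
    then obtain x where "\<And>k::nat. penalized_objective EE II f c (R + real k) x \<le> M"
      using R0 common_sublevel_point[of R EE II f c M] by (auto simp: R_def)
    then have x: "feasible EE II c x" "f x \<le> M"
      using feasible_if_penalized_bounded[of EE II R f c x M] assms(1,2) by (auto simp: R_def)
    have "?primal \<le> (SUP p\<in>?A. ?L p x)"
      by (rule INF_lower) simp
    also have "\<dots> \<le> ereal M"
      using x(2)
      by (intro SUP_least) (auto intro: order_trans[OF aug_lagrangian_le_objective[OF x(1)]])
    finally show ?thesis .
  qed
  then have "?primal \<le> ?dual"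
    by (meson ereal_dense2 leD leI order_trans dual_order.strict_trans1)
  then show "(INF x. SUP (\<rho>, lam, mu) \<in> ?A. ereal (aug_lagrangian EE II f c \<rho> x lam mu))
      \<le> (SUP (\<rho>, lam, mu) \<in> ?A. INF x. ereal (aug_lagrangian EE II f c \<rho> x lam mu))"
    by (simp only: dual_eq primal_eq)
qed

end
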